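(* Let $n,s,t$ be positive integers with $n\geq t\geq s\geq 2$. Every edge-colored graph $G$ on $n$ vertices with $\sum_{v\in V(G)}d^c(v)>n^2/2+\sigma_{s,t}\,n^{2-1/s}+sn$ contains a properly colored $K_{s,t}$, where $\sigma_{s,t}=s\left(\frac{t-1}{(s-1)!}\right)^{1/s}$.
   Context: All graphs are finite and simple. An edge-colored graph is a graph with a color assigned to each edge (not necessarily proper). $d^c(v)$ is the number of distinct colors on edges incident to $v$. A subgraph is properly colored if any two adjacent edges of it receive different colors. *)

theory Defs
  imports Complex_Main "HOL-Library.Ramsey"
begin

(* A graph is a pair of a vertex set V and an edge set E of 2-element subsets of V;
   \<open>nsets V 2\<close> is the set of all 2-element subsets of V. *)
definition simple_graph :: "'a set \<Rightarrow> 'a set set \<Rightarrow> bool" where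
  "simple_graph V E \<longleftrightarrow> finite V \<and> E \<subseteq> nsets V 2"

definition is_subgraph :: "'a set \<Rightarrow> 'a set set \<Rightarrow> 'a set \<Rightarrow> 'a set set \<Rightarrow> bool" where
  "is_subgraph W F V E \<longleftrightarrow> simple_graph W F \<and> W \<subseteq> V \<and> F \<subseteq> E"

definition is_complete_bipartite :: "nat \<Rightarrow> nat \<Rightarrow> 'a set \<Rightarrow> 'a set set \<Rightarrow> bool" where
  "is_complete_bipartite s t W F \<longleftrightarrow>
     (\<exists>A B. finite A \<and> finite B \<and> A \<inter> B = {} \<and> card A = s \<and> card B = t \<and>
            W = A \<union> B \<and> F = {{a, b} | a b. a \<in> A \<and> b \<in> B})"

(* An edge-coloring is an arbitrary function on edges into an arbitrary type of colors;
   its values off the edge set are irrelevant. *)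
definition color_degree :: "('a set \<Rightarrow> 'c) \<Rightarrow> 'a set set \<Rightarrow> 'a \<Rightarrow> nat" where
  "color_degree c E v = card (c ` {e \<in> E. v \<in> e})"

definition properly_colored :: "('a set \<Rightarrow> 'c) \<Rightarrow> 'a set set \<Rightarrow> bool" where
  "properly_colored c F \<longleftrightarrow>
     (\<forall>e\<in>F. \<forall>f\<in>F. e \<noteq> f \<longrightarrow> e \<inter> f \<noteq> {} \<longrightarrow> c e \<noteq> c f)"

definition sigma_st :: "nat \<Rightarrow> nat \<Rightarrow> real" where
  "sigma_st s t = real s * ((real t - 1) / fact (s - 1)) powr (1 / real s)"

end

(* At each vertex v keep one incident edge of every color, giving a set R v of d^c(v) edges with
   distinct colors. The edges kept at both of their endpoints form a properly colored graph H, and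
   the color degrees sum to at most |E| + |H|, so |H| > sigma_{s,t} n^(2 - 1/s) + s n. This exceeds
   the Kovari-Sos-Turan bound for K_{s,t}, so already H contains K_{s,t}. *)
theory Submission
  imports Defs
begin

section \<open>Properly colored subgraphs from one edge per color at each vertex\<close>

lemma simple_graph_finite_edges:
  assumes "simple_graph V E"
  shows "finite E"
  using assms finite_imp_finite_nsets finite_subset unfolding simple_graph_def by metis

text \<open>Double counting of the pairs of a vertex and an edge kept there: an edge of
  \<open>H\<close> is counted twice, any other edge at most once.\<close>

lemma ex_properly_colored_spanning_subgraph:
  assumes G: "simple_graph V E"
  shows "\<exists>H\<subseteq>E. properly_colored c H \<and> (\<Sum>v\<in>V. color_degree c E v) \<le> card E + card H"
proof -
  have finV: "finite V" and EV: "E \<subseteq> nsets V 2"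
    using G by (auto simp: simple_graph_def)
  have finE: "finite E"
    using G by (rule simple_graph_finite_edges)
  \<comment> \<open>A transversal of the colors at \<open>v\<close>: one incident edge for each
    color seen there.\<close>
  have "\<exists>U\<subseteq>{e \<in> E. v \<in> e}. inj_on c U \<and> c ` {e \<in> E. v \<in> e} = c ` U" for v
    using subset_image_inj[of "c ` {e \<in> E. v \<in> e}" c "{e \<in> E. v \<in> e}"] by blast
  then obtain R where R: "\<And>v. R v \<subseteq> {e \<in> E. v \<in> e}" "\<And>v. inj_on c (R v)"
      "\<And>v. c ` {e \<in> E. v \<in> e} = c ` R v"
    by metis
  define H where "H = {e \<in> E. \<forall>v\<in>e. e \<in> R v}"
  have "properly_colored c H"
    unfolding properly_colored_def
  proof (intro ballI impI)
    fix e f assume ef: "e \<in> H" "f \<in> H" "e \<noteq> f" "e \<inter> f \<noteq> {}"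
    then obtain v where "v \<in> e" "v \<in> f" by blast
    \<comment> \<open>Edges of \<open>H\<close> are kept at every endpoint, so both are
      representatives at the shared vertex, where distinct representatives have distinct
      colors.\<close>
    then have "e \<in> R v" "f \<in> R v" using ef by (auto simp: H_def)
    with R(2)[of v] ef(3) show "c e \<noteq> c f" by (auto dest: inj_onD)
  qed
  moreover have "(\<Sum>v\<in>V. color_degree c E v) \<le> card E + card H"
  proof -
    have "color_degree c E v = (\<Sum>e\<in>E. if e \<in> R v then 1 else 0)" for v
    proof -
      have "color_degree c E v = card (R v)"
        unfolding color_degree_def R(3) by (simp add: card_image R(2))
      also have "R v = {e \<in> E. e \<in> R v}" using R(1) by blast
      finally show ?thesis using finE by (simp add: sum.If_cases Int_def)
    qed
    then have "(\<Sum>v\<in>V. color_degree c E v) = (\<Sum>e\<in>E. \<Sum>v\<in>V. if e \<in> R v then 1 else 0)"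
      by (simp add: sum.swap[of _ E V])
    also have "\<dots> \<le> (\<Sum>e\<in>E. 1 + (if e \<in> H then 1 else 0))"
    proof (rule sum_mono)
      fix e assume e: "e \<in> E"
      then have fine: "finite e" and ce: "card e = 2" using EV by (auto simp: nsets_def)
      have sub: "{v \<in> V. e \<in> R v} \<subseteq> e" using R(1) by blast
      have "card {v \<in> V. e \<in> R v} \<le> 1 + (if e \<in> H then 1 else 0)"
      proof (cases "e \<in> H")
        case True
        then show ?thesis using card_mono[OF fine sub] ce by simp
      next
        case False
        \<comment> \<open>Some endpoint of \<open>e\<close> does not keep it, which leaves at most
          one that does.\<close>
        then have "{v \<in> V. e \<in> R v} \<subset> e" using sub e by (auto simp: H_def)
        then have "card {v \<in> V. e \<in> R v} < card e" by (rule psubset_card_mono[OF fine])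
        then show ?thesis using ce False by simp
      qed
      then show "(\<Sum>v\<in>V. if e \<in> R v then 1 else 0) \<le> (1 + (if e \<in> H then 1 else 0) :: nat)"
        using finV by (simp add: sum.If_cases Int_def)
    qed
    also have "\<dots> = card E + card (E \<inter> H)"
      using finE by (simp only: sum.distrib) (simp add: sum.If_cases Int_def)
    also have "E \<inter> H = H" by (auto simp: H_def)
    finally show ?thesis .
  qed
  moreover have "H \<subseteq> E" by (auto simp: H_def)
  ultimately show ?thesis by blast
qed

section \<open>The Kovari-Sos-Turan bound\<close>

text \<open>The handshake lemma, with degrees as neighborhood sizes because the counting of common
  neighbors below works with neighborhoods.\<close>

lemma sum_degree_eq:
  assumes G: "simple_graph V E"
  shows "(\<Sum>v\<in>V. card {u. {u, v} \<in> E}) = 2 * card E"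
proof -
  have finV: "finite V" and EV: "E \<subseteq> nsets V 2"
    using G by (auto simp: simple_graph_def)
  have finE: "finite E"
    using G by (rule simple_graph_finite_edges)
  have deg: "card {u. {u, v} \<in> E} = card {e \<in> E. v \<in> e}" for v
  proof -
    have "bij_betw (\<lambda>u. {u, v}) {u. {u, v} \<in> E} {e \<in> E. v \<in> e}"
      unfolding bij_betw_def
    proof
      show "inj_on (\<lambda>u. {u, v}) {u. {u, v} \<in> E}"
        by (auto simp: inj_on_def doubleton_eq_iff)
      have "e \<in> (\<lambda>u. {u, v}) ` {u. {u, v} \<in> E}" if "e \<in> E" "v \<in> e" for e
      proof -
        have "card e = 2" using that EV by (auto simp: nsets_def)
        then obtain x y where "e = {x, y}" by (auto simp: card_2_iff)
        then show ?thesis using that by (auto simp: insert_commute)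
      qed
      then show "(\<lambda>u. {u, v}) ` {u. {u, v} \<in> E} = {e \<in> E. v \<in> e}" by auto
    qed
    then show ?thesis by (rule bij_betw_same_card)
  qed
  have "(\<Sum>v\<in>V. card {e \<in> E. v \<in> e}) = 2 * card E"
  proof (rule sum_multicount[OF finV finE], intro ballI)
    fix e assume "e \<in> E"
    then have "e \<subseteq> V" "card e = 2" using EV by (auto simp: nsets_def)
    then show "card {v \<in> V. v \<in> e} = 2" by (simp add: Int_absorb1 flip: Int_def)
  qed
  then show ?thesis by (simp add: deg)
qed

text \<open>Double counting of the pairs \<open>(v, S)\<close> where \<open>S\<close> is an
  \<open>s\<close>-subset of \<open>N v\<close>.\<close>

lemma sum_binomial_le:
  assumes finV: "finite V" and NV: "\<And>v. v \<in> V \<Longrightarrow> N v \<subseteq> V"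
    and less: "\<And>S. S \<subseteq> V \<Longrightarrow> card S = s \<Longrightarrow> card {v \<in> V. S \<subseteq> N v} \<le> k"
  shows "(\<Sum>v\<in>V. card (N v) choose s) \<le> k * (card V choose s)"
proof -
  let ?P = "{S. S \<subseteq> V \<and> card S = s}"
  have finP: "finite ?P" using finV by simp
  have "(\<Sum>v\<in>V. card (N v) choose s) = (\<Sum>v\<in>V. \<Sum>S\<in>?P. if S \<subseteq> N v then 1 else 0)"
  proof (rule sum.cong)
    fix v assume v: "v \<in> V"
    have "card (N v) choose s = card {S. S \<subseteq> N v \<and> card S = s}"
      using n_subsets[of "N v" s] NV[OF v] finV finite_subset by metis
    also have "{S. S \<subseteq> N v \<and> card S = s} = {S \<in> ?P. S \<subseteq> N v}" using NV[OF v] by auto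
    finally show "card (N v) choose s = (\<Sum>S\<in>?P. if S \<subseteq> N v then 1 else 0)"
      using finP by (simp add: sum.If_cases Int_def)
  qed simp
  also have "\<dots> = (\<Sum>S\<in>?P. \<Sum>v\<in>V. if S \<subseteq> N v then 1 else 0)" by (rule sum.swap)
  also have "\<dots> = (\<Sum>S\<in>?P. card {v \<in> V. S \<subseteq> N v})"
    using finV by (simp add: sum.If_cases Int_def)
  also have "\<dots> \<le> card ?P * k"
    using sum_bounded_above[of ?P "\<lambda>S. card {v \<in> V. S \<subseteq> N v}" k] less by auto
  finally show ?thesis using n_subsets[OF finV, of s] by (simp add: mult.commute)
qed

text \<open>The right-hand side is the falling factorial of \<open>d\<close> with \<open>s\<close>
  factors, the smallest of which is \<open>d + 1 - s\<close>.\<close>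

lemma power_le_fact_binomial: "(d + 1 - s) ^ s \<le> fact s * (d choose s)"
proof (cases "s \<le> d")
  case False
  \<comment> \<open>Here \<open>s > 0\<close> and the truncated difference is 0, so both sides
    vanish.\<close>
  then show ?thesis by (cases s) auto
next
  case True
  have "(d + 1 - s) ^ s = (\<Prod>i<s. d + 1 - s)" by simp
  also have "\<dots> \<le> (\<Prod>i<s. d - i)" by (rule prod_mono) auto
  also have "real \<dots> = fact s * real (d choose s)"
  proof -
    have "(\<Prod>i<s. real (d - i)) = (\<Prod>i<s. real d - real i)"
      using True by (intro prod.cong) auto
    then show ?thesis
      by (simp add: binomial_gbinomial gbinomial_prod_rev atLeast0LessThan)
  qed
  then have "(\<Prod>i<s. d - i) = fact s * (d choose s)"
    by (metis of_nat_eq_iff of_nat_fact of_nat_mult)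
  finally show ?thesis .
qed

text \<open>A crude replacement for convexity of the power function: it loses a factor 2 in the leading
  constant, which the bound below can afford.\<close>

lemma power_ge_linear:
  fixes x a :: real
  assumes "x \<ge> 0" "a \<ge> 0" "s \<ge> 1"
  shows "a ^ (s - 1) * (x - a) \<le> x ^ s"
proof (cases "a \<le> x")
  case True
  have "a ^ (s - 1) * (x - a) \<le> x ^ (s - 1) * x"
    using assms True by (intro mult_mono power_mono) auto
  then show ?thesis using assms power_minus_mult[of s x] by simp
next
  case False
  then have "a ^ (s - 1) * (x - a) \<le> 0" using assms by (intro mult_nonneg_nonpos) auto
  also have "0 \<le> x ^ s" using assms by simp
  finally show ?thesis .
qed

text \<open>If every \<open>s\<close>-set had fewer than \<open>t\<close> common neighbors, double
  counting would bound the sum of the \<open>s\<close>-th powers of the degrees, each lowered by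
  \<open>s - 1\<close>, by \<open>(t - 1) * n ^ s\<close>. The number of edges makes the average
  degree too large for that.\<close>

lemma kovari_sos_turan:
  fixes V :: "'a set"
  assumes G: "simple_graph V E" and s: "s \<ge> 1" and t: "t \<ge> 2"
    and E: "real (card E) > (real t - 1) powr (1 / real s) * real (card V) powr (2 - 1 / real s)
                              + real s * real (card V)"
  shows "\<exists>W F. is_subgraph W F V E \<and> is_complete_bipartite s t W F"
proof -
  have finV: "finite V" and EV: "E \<subseteq> nsets V 2"
    using G by (auto simp: simple_graph_def)
  define n where "n = card V"
  define N where "N v = {u. {u, v} \<in> E}" for v
  have NV: "N v \<subseteq> V" and irr: "v \<notin> N v" for v
    using EV by (auto simp: N_def nsets_def)
  have n: "n > 0"
  proof (rule ccontr)
    assume "\<not> n > 0"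
    then have "E = {}" using EV finV by (auto simp: n_def nsets_def)
    then have "card E = 0" by simp
    moreover have "(real t - 1) powr (1 / real s) * real (card V) powr (2 - 1 / real s)
        + real s * real (card V) \<ge> 0"
      using t by (intro add_nonneg_nonneg mult_nonneg_nonneg) auto
    ultimately show False using E by linarith
  qed
  \<comment> \<open>The critical degree: \<open>n * a\<close> is the leading term of the edge bound,
    and \<open>n * a ^ s\<close> equals the upper bound \<open>(t - 1) * n ^ s\<close> on the power
    sum.\<close>
  define a where "a = (real t - 1) powr (1 / real s) * real n powr (1 - 1 / real s)"
  have a0: "a > 0" using t n by (simp add: a_def)
  have an: "real n * a = (real t - 1) powr (1 / real s) * real n powr (2 - 1 / real s)"
  proof -
    have "real n * real n powr (1 - 1 / real s) = real n powr (2 - 1 / real s)"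
      using n powr_add[of "real n" 1 "1 - 1 / real s"] by simp
    then show ?thesis by (simp add: a_def)
  qed
  have as: "real n * a ^ s = (real t - 1) * real n ^ s"
  proof -
    have "a ^ s = (real t - 1) * real n powr (real s - 1)"
      using s t n unfolding a_def
      by (simp add: power_mult_distrib powr_power algebra_simps)
    moreover have "real n * real n powr (real s - 1) = real n ^ s"
      using n powr_add[of "real n" 1 "real s - 1"] by (simp add: powr_realpow)
    ultimately show ?thesis by (metis mult.left_commute)
  qed
  have "\<exists>S\<subseteq>V. card S = s \<and> t \<le> card {v \<in> V. S \<subseteq> N v}"
  proof (rule ccontr)
    assume no: "\<not> ?thesis"
    have "(\<Sum>v\<in>V. card (N v) choose s) \<le> (t - 1) * (n choose s)"
      unfolding n_def using no by (intro sum_binomial_le[OF finV NV]) force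
    then have "fact s * (\<Sum>v\<in>V. card (N v) choose s) \<le> (t - 1) * ((n choose s) * fact s)"
      by (simp add: mult_ac)
    also have "\<dots> \<le> (t - 1) * n ^ s"
      by (intro mult_le_mono binomial_fact_pow) simp
    finally have "(\<Sum>v\<in>V. (card (N v) + 1 - s) ^ s) \<le> (t - 1) * n ^ s"
      unfolding sum_distrib_left by (rule order_trans[OF sum_mono[OF power_le_fact_binomial]])
    from of_nat_mono[OF this, where 'a = real]
    have up: "(\<Sum>v\<in>V. real (card (N v) + 1 - s) ^ s) \<le> (real t - 1) * real n ^ s"
      using t by (simp add: of_nat_diff)
    have "2 * real (card E) - real s * real n = (\<Sum>v\<in>V. real (card (N v)) - real s)"
      using sum_degree_eq[OF G] by (simp add: N_def n_def sum_subtractf flip: of_nat_sum)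
    \<comment> \<open>Truncation only raises negative values to 0, so this also holds at vertices of
      degree below \<open>s\<close>.\<close>
    also have "\<dots> \<le> (\<Sum>v\<in>V. real (card (N v) + 1 - s))"
      by (rule sum_mono) linarith
    \<comment> \<open>Degrees count each edge twice, so \<open>n * a\<close> appears doubled. One
      copy pays for the \<open>a\<close> that \<open>power_ge_linear\<close> subtracts at each
      vertex; the other yields the contradiction.\<close>
    finally have "2 * (real n * a) < (\<Sum>v\<in>V. real (card (N v) + 1 - s))"
      using E[folded n_def] mult_nonneg_nonneg[of "real s" "real n"] unfolding an by linarith
    then have "a ^ (s - 1) * (real n * a) < a ^ (s - 1) * ((\<Sum>v\<in>V. real (card (N v) + 1 - s)) - real n * a)"
      using a0 by (intro mult_strict_left_mono) (linarith, simp)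
    also have "\<dots> = (\<Sum>v\<in>V. a ^ (s - 1) * (real (card (N v) + 1 - s) - a))"
      unfolding sum_distrib_left[symmetric] by (simp add: n_def sum_subtractf)
    also have "\<dots> \<le> (\<Sum>v\<in>V. real (card (N v) + 1 - s) ^ s)"
      using a0 s by (intro sum_mono power_ge_linear) auto
    also note up
    also have "(real t - 1) * real n ^ s = a ^ (s - 1) * (real n * a)"
      using s power_minus_mult[of s a] unfolding as[symmetric] by (simp add: mult.left_commute)
    finally show False by simp
  qed
  then obtain S where S: "S \<subseteq> V" "card S = s" "t \<le> card {v \<in> V. S \<subseteq> N v}" by blast
  then obtain B where B: "B \<subseteq> {v \<in> V. S \<subseteq> N v}" "card B = t" "finite B"
    using obtain_subset_with_card_n[OF S(3)] by blast
  let ?F = "{{a, b} | a b. a \<in> S \<and> b \<in> B}"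
  have FE: "?F \<subseteq> E" using B by (auto simp: N_def)
  \<comment> \<open>A vertex of \<open>B\<close> has all of \<open>S\<close> in its neighborhood but
    is not its own neighbor.\<close>
  moreover have disj: "S \<inter> B = {}" using B irr by blast
  moreover have "?F \<subseteq> nsets (S \<union> B) 2"
    using disj by (fastforce simp: nsets_def card_insert_if)
  ultimately have "is_subgraph (S \<union> B) ?F V E" "is_complete_bipartite s t (S \<union> B) ?F"
    using S B finite_subset[OF S(1) finV]
    by (auto simp: is_subgraph_def simple_graph_def is_complete_bipartite_def)
  then show ?thesis by blast
qed

section \<open>Comparison of constants and conclusion\<close>

text \<open>Moving the factor \<open>s\<close> under the root turns it into \<open>s ^ s\<close>,
  which is at least \<open>fact s\<close> and hence outweighs the denominator
  \<open>fact (s - 1)\<close>. The edge surplus in the main theorem therefore exceeds the threshold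
  of \<open>kovari_sos_turan\<close>.\<close>

lemma sigma_st_ge:
  assumes "s \<ge> 1" "t \<ge> 1"
  shows "(real t - 1) powr (1 / real s) \<le> sigma_st s t"
proof -
  have "fact (s - 1) \<le> (fact s :: real)" by (rule fact_mono) simp
  also have "\<dots> \<le> real s ^ s" using fact_le_power[of s, where 'a = real] by simp
  finally have "real t - 1 \<le> real s ^ s * ((real t - 1) / fact (s - 1))"
    using assms mult_right_mono[of "fact (s - 1)" "real s ^ s" "real t - 1"]
    by (simp add: field_simps)
  then have "(real t - 1) powr (1 / real s)
      \<le> (real s ^ s * ((real t - 1) / fact (s - 1))) powr (1 / real s)"
    using assms by (intro powr_mono2) auto
  also have "\<dots> = (real s ^ s) powr (1 / real s) * ((real t - 1) / fact (s - 1)) powr (1 / real s)"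
    using assms by (intro powr_mult)
  also have "(real s ^ s) powr (1 / real s) = real s"
    using assms by (simp add: powr_powr flip: powr_realpow)
  finally show ?thesis by (simp add: sigma_st_def)
qed

theorem theorem4p2:
  fixes n s t :: nat
    and V :: "'a set"
    and E :: "'a set set"
    and c :: "'a set \<Rightarrow> 'c"
  assumes "s \<ge> 2" and "t \<ge> s" and "n \<ge> t"
    and "simple_graph V E" and "card V = n"
    and "real (\<Sum>v\<in>V. color_degree c E v)
           > (real n)\<^sup>2 / 2 + sigma_st s t * real n powr (2 - 1 / real s) + real s * real n"
  shows "\<exists>W F. is_subgraph W F V E \<and> is_complete_bipartite s t W F \<and> properly_colored c F"
proof -
  obtain H where H: "H \<subseteq> E" "properly_colored c H"
      "(\<Sum>v\<in>V. color_degree c E v) \<le> card E + card H"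
    using ex_properly_colored_spanning_subgraph[OF assms(4)] by blast
  have finV: "finite V" and EV: "E \<subseteq> nsets V 2"
    using assms(4) by (auto simp: simple_graph_def)
  have GH: "simple_graph V H" using H(1) assms(4) by (auto simp: simple_graph_def)
  \<comment> \<open>The bound on \<open>card E\<close> uses up the quadratic term of the hypothesis
    and leaves the other two terms to \<open>card H\<close>.\<close>
  have "card E \<le> n choose 2"
    using card_mono[OF finite_imp_finite_nsets[OF finV] EV] assms(5) by (simp add: card_nsets)
  then have "2 * card E \<le> n * n"
    by (auto simp: choose_two diff_mult_distrib2 dest!: mult_le_mono2[of _ _ 2])
  then have "real (card E) \<le> (real n)\<^sup>2 / 2"
    by (simp add: power2_eq_square flip: of_nat_mult)
  moreover have "(real t - 1) powr (1 / real s) * real n powr (2 - 1 / real s)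
      \<le> sigma_st s t * real n powr (2 - 1 / real s)"
    using assms by (intro mult_right_mono sigma_st_ge) auto
  ultimately have "real (card H) > (real t - 1) powr (1 / real s) * real (card V) powr (2 - 1 / real s)
      + real s * real (card V)"
    using assms(5,6) of_nat_mono[OF H(3), where 'a = real] by simp
  with GH assms(1,2) obtain W F where WF: "is_subgraph W F V H" "is_complete_bipartite s t W F"
    using kovari_sos_turan[of V H s t] by auto
  \<comment> \<open>Proper coloring passes from \<open>H\<close> to its subset
    \<open>F\<close>.\<close>
  then have "is_subgraph W F V E" "properly_colored c F"
    using H(1,2) unfolding is_subgraph_def properly_colored_def by blast+
  with WF(2) show ?thesis by blast
qed

end
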